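(* Let $U_0\in (V_{N_g})^N\cap\mathcal M^N$, $\Delta t_n>0$ and $p_n\in\mathbb N_+$ for $n\in\mathbb N$, and let $\{U_n\}$ be obtained from the orthogonality preserving iteration $$U_{n+1/2}^{(0)}=U_n,\qquad U_{n+1/2}^{(k)}=\Big(I+\frac{\Delta t_n}2\mathcal A_{U_{n+1/2}^{(k-1)}}\Big)^{-1}U_n\ (k=1,\dots,p_n),\qquad U_{n+1}=2U_{n+1/2}^{(p_n)}-U_n .$$ Then $U_n\in (V_{N_g})^N\cap\mathcal M^N$ for all $n\in\mathbb N$.
   Context: Setting. $N\ge 1$; $V_{N_g}\subset H^1(\mathbb R^3)$ is a finite-dimensional space (dimension $N_g$) of real-valued functions. For $N$-tuples $\Psi,\Phi$ of functions, $\langle\Psi^\top\Phi\rangle=((\psi_i,\varphi_j)_{L^2(\mathbb R^3)})_{i,j=1}^N$, $(\Psi,\Phi)=\mathrm{tr}\langle\Psi^\top\Phi\rangle$. For $P\in\mathbb R^{N\times N}$, $UP$ is the $N$-tuple with $i$-th entry $\sum_j p_{ji}u_j$. $\mathcal M^N=\{U\in (H^1(\mathbb R^3))^N:\langle U^\top U\rangle=I_N\}$. Energy. $E$ is the Kohn-Sham energy $$E(U)=\sum_{i=1}^N\int_{\mathbb R^3}|\nabla u_i|^2\,dr+\int_{\mathbb R^3}V_{ext}\rho_U\,dr+\frac12\iint\frac{\rho_U(r)\rho_U(r')}{|r-r'|}\,dr\,dr'+\int_{\mathbb R^3}\varepsilon_{xc}(\rho_U)\rho_U\,dr,\qquad \rho_U=2\sum_{i=1}^N|u_i|^2,$$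 where $V_{ext}$ is the external potential (for full potential calculations $V_{ext}(r)=-\sum_{I=1}^M Z_I/|r-R_I|$). The exchange-correlation term is assumed differentiable, with potential $v_{xc}(\rho)=\delta(\rho\,\varepsilon_{xc}(\rho))/\delta\rho$; thus $E$ is differentiable on $(V_{N_g})^N$, and $\nabla E(U)\in (V_{N_g})^N$ denotes its gradient with respect to $(\cdot,\cdot)$, i.e. for every $v\in V_{N_g}$ $$((\nabla E(U))_i,v)_{L^2}=4\Big(\tfrac12(\nabla u_i,\nabla v)_{L^2}+(V_{ext}u_i,v)_{L^2}+\Big(\int\frac{\rho_U(r')}{|\cdot-r'|}dr'\,u_i,v\Big)_{L^2}+(v_{xc}(\rho_U)u_i,v)_{L^2}\Big).$$ Operator. For $U,V\in (V_{N_g})^N$, $\mathcal A_UV=\nabla E(U)\langle U^\top V\rangle-U\langle(\nabla E(U))^\top V\rangle$; this is a skew-symmetric linear operator in $V$, so $I+s\mathcal A_U$ is invertible on $(V_{N_g})^N$ for all $s\in\mathbb R$. *)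

theory Defs
  imports "HOL-Analysis.Analysis"
begin

section \<open>The real Hilbert space $L^2(R^3)$\<close>

definition square_integrable :: "(real^3 \<Rightarrow> real) \<Rightarrow> bool" where
  "square_integrable f \<longleftrightarrow>
     f \<in> borel_measurable lborel \<and> integrable lborel (\<lambda>r. (f r)\<^sup>2)"

definition L2_rel :: "(real^3 \<Rightarrow> real) \<Rightarrow> (real^3 \<Rightarrow> real) \<Rightarrow> bool" where
  "L2_rel f g \<longleftrightarrow> square_integrable f \<and> square_integrable g \<and> (AE r in lborel. f r = g r)"

lemma square_integrable_zero: "square_integrable (\<lambda>r. 0)"
  by (simp add: square_integrable_def)

lemma square_integrable_mult:
  assumes "square_integrable f" "square_integrable g"
  shows "integrable lborel (\<lambda>r. f r * g r)"
proof (rule Bochner_Integration.integrable_bound)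
  show "integrable lborel (\<lambda>r. (f r)\<^sup>2 + (g r)\<^sup>2)"
    using assms by (simp add: square_integrable_def)
  show "(\<lambda>r. f r * g r) \<in> borel_measurable lborel"
    using assms by (auto simp: square_integrable_def)
  have "\<bar>a * b\<bar> \<le> a\<^sup>2 + b\<^sup>2" for a b :: real
    using sum_squares_bound[of "\<bar>a\<bar>" "\<bar>b\<bar>"] abs_ge_zero[of "a * b"]
    unfolding abs_mult power2_abs by linarith
  then show "AE r in lborel. norm (f r * g r) \<le> norm ((f r)\<^sup>2 + (g r)\<^sup>2)"
    by (intro AE_I2) simp
qed

lemma square_integrable_add:
  assumes "square_integrable f" "square_integrable g"
  shows "square_integrable (\<lambda>r. f r + g r)"
proof -
  have "integrable lborel (\<lambda>r. (f r)\<^sup>2 + (g r)\<^sup>2 + 2 * (f r * g r))"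
    using assms square_integrable_mult[OF assms] by (simp add: square_integrable_def)
  then show ?thesis
    using assms by (auto simp: square_integrable_def power2_sum mult.assoc)
qed

lemma square_integrable_scale:
  "square_integrable f \<Longrightarrow> square_integrable (\<lambda>r. c * f r)"
  by (auto simp: square_integrable_def power_mult_distrib)

lemma square_integrable_uminus:
  "square_integrable f \<Longrightarrow> square_integrable (\<lambda>r. - f r)"
  using square_integrable_scale[of f "-1"] by simp

lemma square_integrable_diff:
  assumes "square_integrable f" "square_integrable g"
  shows "square_integrable (\<lambda>r. f r - g r)"
  using square_integrable_add[OF assms(1) square_integrable_uminus[OF assms(2)]] by simp

lemma part_equivp_L2_rel: "part_equivp L2_rel"
proof (rule part_equivpI)
  show "\<exists>f. L2_rel f f"
    using square_integrable_zero by (auto simp: L2_rel_def)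
  show "symp L2_rel"
    by (auto simp: symp_def L2_rel_def elim: AE_mp)
  show "transp L2_rel"
    by (auto simp: transp_def L2_rel_def elim!: AE_mp)
qed

text \<open>The morphism \<open>L2_fun\<close> selects a representative of a class.\<close>

quotient_type L2 = "real^3 \<Rightarrow> real" / partial: L2_rel
  morphisms L2_fun L2_class
  by (rule part_equivp_L2_rel)

instantiation L2 :: real_inner
begin

lift_definition zero_L2 :: L2 is "\<lambda>r. 0"
  by (simp add: L2_rel_def square_integrable_zero)

lift_definition plus_L2 :: "L2 \<Rightarrow> L2 \<Rightarrow> L2" is "\<lambda>f g r. f r + g r"
  by (auto simp: L2_rel_def square_integrable_add elim!: AE_mp)

lift_definition minus_L2 :: "L2 \<Rightarrow> L2 \<Rightarrow> L2" is "\<lambda>f g r. f r - g r"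
  by (auto simp: L2_rel_def square_integrable_diff elim!: AE_mp)

lift_definition uminus_L2 :: "L2 \<Rightarrow> L2" is "\<lambda>f r. - f r"
  by (auto simp: L2_rel_def square_integrable_uminus elim!: AE_mp)

lift_definition scaleR_L2 :: "real \<Rightarrow> L2 \<Rightarrow> L2" is "\<lambda>c f r. c * f r"
  by (auto simp: L2_rel_def square_integrable_scale elim!: AE_mp)

lift_definition inner_L2 :: "L2 \<Rightarrow> L2 \<Rightarrow> real" is "\<lambda>f g. LINT r|lborel. f r * g r"
proof -
  fix f f' g g'
  assume "L2_rel f f'" "L2_rel g g'"
  then show "(LINT r|lborel. f r * g r) = (LINT r|lborel. f' r * g' r)"
    by (intro integral_cong_AE) (auto simp: L2_rel_def square_integrable_def elim!: AE_mp)
qed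

definition norm_L2 :: "L2 \<Rightarrow> real" where "norm_L2 u = sqrt (inner u u)"
definition dist_L2 :: "L2 \<Rightarrow> L2 \<Rightarrow> real" where "dist_L2 u v = norm (u - v)"
definition sgn_L2 :: "L2 \<Rightarrow> L2" where "sgn_L2 u = inverse (norm u) *\<^sub>R u"
definition uniformity_L2 :: "(L2 \<times> L2) filter" where
  "uniformity_L2 = (INF e\<in>{0<..}. principal {(u, v). dist u v < e})"
definition open_L2 :: "L2 set \<Rightarrow> bool" where
  "open_L2 S \<longleftrightarrow> (\<forall>u\<in>S. eventually (\<lambda>(u', v). u' = u \<longrightarrow> v \<in> S) uniformity)"

instance
proof
  fix u v w :: L2 and a b :: real and S :: "L2 set"
  show "u + v + w = u + (v + w)"
    by transfer (auto simp: L2_rel_def square_integrable_add add.assoc)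
  show "u + v = v + u"
    by transfer (auto simp: L2_rel_def square_integrable_add add.commute)
  show "0 + u = u"
    by transfer (auto simp: L2_rel_def)
  show "- u + u = 0"
    by transfer (auto simp: L2_rel_def square_integrable_zero)
  show "u - v = u + - v"
    by transfer (auto simp: L2_rel_def square_integrable_diff)
  show "a *\<^sub>R (u + v) = a *\<^sub>R u + a *\<^sub>R v"
    by transfer
      (auto simp: L2_rel_def square_integrable_add square_integrable_scale distrib_left)
  show "(a + b) *\<^sub>R u = a *\<^sub>R u + b *\<^sub>R u"
    by transfer
      (auto simp: L2_rel_def square_integrable_add square_integrable_scale distrib_right)
  show "a *\<^sub>R b *\<^sub>R u = (a * b) *\<^sub>R u"
    by transfer (auto simp: L2_rel_def square_integrable_scale mult.assoc)
  show "1 *\<^sub>R u = u"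
    by transfer (auto simp: L2_rel_def)
  show "dist u v = norm (u - v)" by (rule dist_L2_def)
  show "sgn u = inverse (norm u) *\<^sub>R u" by (rule sgn_L2_def)
  show "(uniformity :: (L2 \<times> L2) filter) = (INF e\<in>{0<..}. principal {(x, y). dist x y < e})"
    by (rule uniformity_L2_def)
  show "open S = (\<forall>x\<in>S. \<forall>\<^sub>F (x', y) in uniformity. x' = x \<longrightarrow> y \<in> S)"
    by (rule open_L2_def)
  show "inner u v = inner v u"
    by transfer (simp add: mult.commute)
  show "inner (u + v) w = inner u w + inner v w"
    by transfer (simp add: L2_rel_def distrib_right square_integrable_mult)
  show "inner (a *\<^sub>R u) v = a * inner u v"
    by transfer (simp add: mult.assoc)
  show "0 \<le> inner u u"
    by transfer simp
  show "inner u u = 0 \<longleftrightarrow> u = 0"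
  proof transfer
    fix f assume "L2_rel f f"
    then have f: "square_integrable f" by (simp add: L2_rel_def)
    then have "(LINT r|lborel. (f r)\<^sup>2) = 0 \<longleftrightarrow> (AE r in lborel. (f r)\<^sup>2 = 0)"
      by (intro integral_nonneg_eq_0_iff_AE) (auto simp: square_integrable_def)
    then show "(LINT r|lborel. f r * f r) = 0 \<longleftrightarrow> L2_rel f (\<lambda>r. 0)"
      using f square_integrable_zero by (simp add: L2_rel_def power2_eq_square)
  qed
  show "norm u = sqrt (inner u u)" by (rule norm_L2_def)
qed

end

section \<open>The Sobolev space $H^1(R^3)$\<close>

definition partial_deriv :: "3 \<Rightarrow> (real^3 \<Rightarrow> real) \<Rightarrow> real^3 \<Rightarrow> real" where
  "partial_deriv k f r = frechet_derivative f (at r) (axis k 1)"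

primrec continuously_differentiable :: "nat \<Rightarrow> (real^3 \<Rightarrow> real) \<Rightarrow> bool" where
  "continuously_differentiable 0 f \<longleftrightarrow> continuous_on UNIV f"
| "continuously_differentiable (Suc m) f \<longleftrightarrow>
     (\<forall>r. f differentiable (at r)) \<and>
     (\<forall>k. continuously_differentiable m (partial_deriv k f))"

definition test_function :: "(real^3 \<Rightarrow> real) \<Rightarrow> bool" where
  "test_function \<phi> \<longleftrightarrow>
     (\<forall>m. continuously_differentiable m \<phi>) \<and> compact (closure {r. \<phi> r \<noteq> 0})"

definition is_weak_gradient :: "L2 \<Rightarrow> L2^3 \<Rightarrow> bool" where
  "is_weak_gradient u g \<longleftrightarrow>
     (\<forall>\<phi> k. test_function \<phi> \<longrightarrow>
        (LINT r|lborel. L2_fun u r * partial_deriv k \<phi> r) =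
        - (LINT r|lborel. L2_fun (g $ k) r * \<phi> r))"

definition H1 :: "L2 set" where
  "H1 = {u. \<exists>g. is_weak_gradient u g}"

definition weak_gradient :: "L2 \<Rightarrow> L2^3" where
  "weak_gradient u = (THE g. is_weak_gradient u g)"

section \<open>Tuples of functions\<close>

text \<open>An \<open>N\<close>-tuple is a vector indexed by a finite type \<open>'n\<close> with \<open>CARD('n) = N\<close>.\<close>

definition tuples :: "L2 set \<Rightarrow> (L2^'n) set" where
  "tuples V = {U. \<forall>i. U $ i \<in> V}"

definition gram :: "L2^'n \<Rightarrow> L2^'n \<Rightarrow> real^'n^'n" where
  "gram \<Psi> \<Phi> = (\<chi> i j. inner (\<Psi> $ i) (\<Phi> $ j))"

definition tuple_inner :: "L2^'n \<Rightarrow> L2^'n \<Rightarrow> real" where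
  "tuple_inner \<Psi> \<Phi> = trace (gram \<Psi> \<Phi>)"

definition tuple_mult :: "L2^'n \<Rightarrow> real^'n^'n \<Rightarrow> L2^'n" where
  "tuple_mult U P = (\<chi> i. \<Sum>j\<in>UNIV. P $ j $ i *\<^sub>R U $ j)"

definition stiefel :: "(L2^'n) set" where
  "stiefel = {U \<in> tuples H1. gram U U = mat 1}"

section \<open>The Kohn-Sham energy\<close>

definition density :: "L2^'n \<Rightarrow> real^3 \<Rightarrow> real" where
  "density U r = 2 * (\<Sum>i\<in>UNIV. \<bar>L2_fun (U $ i) r\<bar>\<^sup>2)"

definition kinetic_energy :: "L2^'n \<Rightarrow> real" where
  "kinetic_energy U =
     (\<Sum>i\<in>UNIV. LINT r|lborel. (\<Sum>k\<in>UNIV. \<bar>L2_fun (weak_gradient (U $ i) $ k) r\<bar>\<^sup>2))"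

definition external_energy :: "(real^3 \<Rightarrow> real) \<Rightarrow> L2^'n \<Rightarrow> real" where
  "external_energy Vext U = (LINT r|lborel. Vext r * density U r)"

definition hartree_energy :: "L2^'n \<Rightarrow> real" where
  "hartree_energy U =
     1/2 * (LINT r|lborel. LINT r'|lborel. density U r * density U r' / norm (r - r'))"

text \<open>The exchange-correlation energy per particle \<open>exc\<close> is an arbitrary operator on densities;
  local functionals have the form \<open>exc \<rho> = (\<lambda>r. e (\<rho> r))\<close>.\<close>

definition xc_energy :: "((real^3 \<Rightarrow> real) \<Rightarrow> real^3 \<Rightarrow> real) \<Rightarrow> L2^'n \<Rightarrow> real" where
  "xc_energy exc U = (LINT r|lborel. exc (density U) r * density U r)"

definition kohn_sham_energy ::
    "(real^3 \<Rightarrow> real) \<Rightarrow> ((real^3 \<Rightarrow> real) \<Rightarrow> real^3 \<Rightarrow> real) \<Rightarrow> L2^'n \<Rightarrow> real" where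
  "kohn_sham_energy Vext exc U =
     kinetic_energy U + external_energy Vext U + hartree_energy U + xc_energy exc U"

text \<open>\<open>vxc\<close> is the functional derivative of the exchange-correlation energy with respect to the
  density, along the densities of tuples in \<open>S\<close>: the first variation of \<open>density U\<close> in the
  direction \<open>\<Phi>\<close> is \<open>4 * (\<Sum>i. u\<^sub>i \<phi>\<^sub>i)\<close>.\<close>

definition xc_potential_on ::
    "(L2^'n) set \<Rightarrow> ((real^3 \<Rightarrow> real) \<Rightarrow> real^3 \<Rightarrow> real)
      \<Rightarrow> ((real^3 \<Rightarrow> real) \<Rightarrow> real^3 \<Rightarrow> real) \<Rightarrow> bool" where
  "xc_potential_on S exc vxc \<longleftrightarrow>
     (\<forall>U\<in>S. \<exists>D. (xc_energy exc has_derivative D) (at U within S) \<and>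
        (\<forall>\<Phi>\<in>S.
           integrable lborel (\<lambda>r. vxc (density U) r *
             (4 * (\<Sum>i\<in>UNIV. L2_fun (U $ i) r * L2_fun (\<Phi> $ i) r))) \<and>
           D \<Phi> = (LINT r|lborel. vxc (density U) r *
             (4 * (\<Sum>i\<in>UNIV. L2_fun (U $ i) r * L2_fun (\<Phi> $ i) r)))))"

text \<open>The gradient within a finite-dimensional subspace \<open>S\<close> of tuples, with respect to
  \<open>tuple_inner\<close>; it is an element of \<open>S\<close>.\<close>

definition gradient_within :: "(L2^'n) set \<Rightarrow> (L2^'n \<Rightarrow> real) \<Rightarrow> L2^'n \<Rightarrow> L2^'n" where
  "gradient_within S E U =
     (THE G. G \<in> S \<and> (E has_derivative (\<lambda>\<Phi>. tuple_inner G \<Phi>)) (at U within S))"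

section \<open>The orthogonality preserving iteration\<close>

definition skew_operator :: "(L2^'n \<Rightarrow> L2^'n) \<Rightarrow> L2^'n \<Rightarrow> L2^'n \<Rightarrow> L2^'n" where
  "skew_operator gradE U W =
     tuple_mult (gradE U) (gram U W) - tuple_mult U (gram (gradE U) W)"

text \<open>The inverse of \<open>I + s A\<^sub>U\<close> as an operator on the subspace \<open>S\<close>.\<close>

definition resolvent_on ::
    "(L2^'n) set \<Rightarrow> (L2^'n \<Rightarrow> L2^'n) \<Rightarrow> real \<Rightarrow> L2^'n \<Rightarrow> L2^'n \<Rightarrow> L2^'n" where
  "resolvent_on S gradE s U = the_inv_into S (\<lambda>W. W + s *\<^sub>R skew_operator gradE U W)"

text \<open>\<open>Uhalf n k\<close> is the \<open>k\<close>-th inner iterate $U_{n+1/2}^{(k)}$ of step \<open>n\<close>.\<close>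

definition orthogonality_preserving_iteration ::
    "(L2^'n) set \<Rightarrow> (L2^'n \<Rightarrow> L2^'n) \<Rightarrow> (nat \<Rightarrow> real) \<Rightarrow> (nat \<Rightarrow> nat)
      \<Rightarrow> (nat \<Rightarrow> L2^'n) \<Rightarrow> (nat \<Rightarrow> nat \<Rightarrow> L2^'n) \<Rightarrow> bool" where
  "orthogonality_preserving_iteration S gradE dt p U Uhalf \<longleftrightarrow>
     (\<forall>n. Uhalf n 0 = U n \<and>
        (\<forall>k\<in>{1..p n}. Uhalf n k = resolvent_on S gradE (dt n / 2) (Uhalf n (k - 1)) (U n)) \<and>
        U (Suc n) = 2 *\<^sub>R Uhalf n (p n) - U n)"

end

theory Submission
  imports Defs
begin

text \<open>If \<open>W\<close> solves \<open>W + s A W = U\<close> with \<open>A = A\<^sub>X\<close>, then the update \<open>2 W - U\<close> equals \<open>W - s A W\<close>.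
  The matrix \<open>gram W (A W)\<close> is antisymmetric for every \<open>X\<close>, so the terms linear in \<open>s\<close> cancel in both
  Gram matrices and \<open>gram (2 W - U) (2 W - U) = gram U U\<close>.
  Antisymmetry also makes \<open>I + s A\<close> injective, hence bijective in finite dimension, so that every
  iterate is well defined.\<close>

section \<open>Gradients in finite-dimensional subspaces\<close>

text \<open>Expanding in an orthogonal spanning set gives the representing vector explicitly, so no
  completeness of the ambient space enters; \<open>L2\<close> is only set up as an inner product
  space.\<close>

lemma Riesz_finite_span:
  fixes D :: "'a::real_inner \<Rightarrow> real"
  assumes "finite B" and "linear D"
  obtains G where "G \<in> span B" and "\<And>x. x \<in> span B \<Longrightarrow> inner G x = D x"
proof -
  obtain C where C: "finite C" "span C = span B" "pairwise orthogonal C"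
    using basis_orthogonal[OF \<open>finite B\<close>] by blast
  define G where "G = (\<Sum>c\<in>C. (D c / inner c c) *\<^sub>R c)"
  have G_base: "inner G x = D x" if "x \<in> C" for x
  proof -
    have "inner G x = (\<Sum>c\<in>C. D c / inner c c * inner c x)"
      by (simp add: G_def inner_sum_left)
    also have "\<dots> = (\<Sum>c\<in>C. if c = x then D x else 0)"
    proof (rule sum.cong)
      \<comment> \<open>The orthogonal set \<open>C\<close> may contain 0. In the case
        \<open>c = x = 0\<close> the quotient is 0 by the division convention, which agrees with
        \<open>D 0 = 0\<close>.\<close>
      fix c assume "c \<in> C"
      then show "D c / inner c c * inner c x = (if c = x then D x else 0)"
        using C(3) that linear_0[OF \<open>linear D\<close>] by (auto simp: pairwise_def orthogonal_def)
    qed simp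
    also have "\<dots> = D x" using that C(1) by simp
    finally show ?thesis .
  qed
  have "G \<in> span C" by (auto simp: G_def intro: span_sum span_scale span_base)
  moreover have "inner G x = D x" if "x \<in> span C" for x
    by (rule linear_eq_on[OF bounded_linear.linear[OF bounded_linear_inner_right] \<open>linear D\<close>
          that G_base])
  ultimately show ?thesis using that C(2) by auto
qed

text \<open>For \<open>y\<close> in \<open>S\<close> the increments \<open>y - x\<close> stay in
  \<open>S\<close>, so the difference quotient only sees the derivative there. This allows replacing
  a derivative by its Riesz representation, which agrees with it only on \<open>S\<close>.\<close>

lemma has_derivative_within_subspace_cong:
  fixes f :: "'a::real_normed_vector \<Rightarrow> 'b::real_normed_vector"
  assumes S: "subspace S" "x \<in> S"
    and f: "(f has_derivative D) (at x within S)"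
    and D': "bounded_linear D'" "\<And>h. h \<in> S \<Longrightarrow> D' h = D h"
  shows "(f has_derivative D') (at x within S)"
proof -
  have "((\<lambda>y. (f y - f x - D (y - x)) /\<^sub>R norm (y - x)) \<longlongrightarrow> 0) (at x within S)"
    using f by (simp add: has_derivative_at_within)
  then have "((\<lambda>y. (f y - f x - D' (y - x)) /\<^sub>R norm (y - x)) \<longlongrightarrow> 0) (at x within S)"
    by (rule Lim_transform_eventually)
      (use S in \<open>auto simp: eventually_at_filter D'(2) subspace_diff\<close>)
  then show ?thesis using D'(1) by (simp add: has_derivative_at_within)
qed

text \<open>Restriction to the line through \<open>x\<close> in direction \<open>h\<close>, which
  stays in \<open>S\<close>, reduces the claim to uniqueness of an ordinary derivative in one real
  variable.\<close>

lemma has_derivative_within_subspace_unique: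
  fixes f :: "'a::real_normed_vector \<Rightarrow> 'b::real_normed_vector"
  assumes S: "subspace S" "x \<in> S" "h \<in> S"
    and D: "(f has_derivative D) (at x within S)" and D': "(f has_derivative D') (at x within S)"
  shows "D h = D' h"
proof -
  let ?l = "\<lambda>t::real. x + t *\<^sub>R h"
  have l: "(?l has_derivative (\<lambda>t. t *\<^sub>R h)) (at 0)"
    by (auto intro!: derivative_eq_intros)
  have sub: "range ?l \<subseteq> S" using S by (auto intro: subspace_add subspace_scale)
  have *: "((\<lambda>t. f (?l t)) has_derivative (\<lambda>t. F (t *\<^sub>R h))) (at 0)"
    if "(f has_derivative F) (at x within S)" for F
    using has_derivative_in_compose[OF l, of f F] has_derivative_subset[OF that sub] by simp
  have "(\<lambda>t. D (t *\<^sub>R h)) = (\<lambda>t. D' (t *\<^sub>R h))"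
    by (rule has_derivative_unique[OF *[OF D] *[OF D']])
  from fun_cong[OF this, of 1] show ?thesis by simp
qed

lemma tuple_inner_eq_inner: "tuple_inner \<Psi> \<Phi> = inner \<Psi> \<Phi>"
  by (simp add: tuple_inner_def gram_def trace_def inner_vec_def)

text \<open>The gradient is a definite description, so membership requires unique existence. The
  Riesz vector of the derivative is a witness; a second candidate equals it because both represent
  the derivative in the direction of their difference.\<close>

lemma gradient_within_in:
  fixes S :: "(L2^'n) set"
  assumes S: "S = span B" "finite B" and U: "U \<in> S"
    and E: "E differentiable (at U within S)"
  shows "gradient_within S E U \<in> S"
proof -
  have sub: "subspace S" using S by simp
  obtain D where D: "(E has_derivative D) (at U within S)"
    using E by (auto simp: differentiable_def)
  obtain G where G: "G \<in> S" "\<And>x. x \<in> S \<Longrightarrow> inner G x = D x"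
    using Riesz_finite_span[OF S(2) has_derivative_linear[OF D]] S(1) by blast
  have "\<exists>!G. G \<in> S \<and> (E has_derivative (\<lambda>\<Phi>. tuple_inner G \<Phi>)) (at U within S)"
  proof (rule ex1I[of _ G])
    show "G \<in> S \<and> (E has_derivative (\<lambda>\<Phi>. tuple_inner G \<Phi>)) (at U within S)"
      unfolding tuple_inner_eq_inner
      using has_derivative_within_subspace_cong[OF sub U D bounded_linear_inner_right] G by blast
  next
    fix G' assume G': "G' \<in> S \<and> (E has_derivative (\<lambda>\<Phi>. tuple_inner G' \<Phi>)) (at U within S)"
    have diff: "G' - G \<in> S" using G G' sub by (auto intro: subspace_diff)
    have "inner G' (G' - G) = D (G' - G)"
      by (rule has_derivative_within_subspace_unique[OF sub U diff _ D])
        (use G' in \<open>simp add: tuple_inner_eq_inner\<close>)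
    then have "inner (G' - G) (G' - G) = 0"
      using G(2)[OF diff] by (simp add: inner_diff_left)
    then show "G' = G" by simp
  qed
  from theI'[OF this] show ?thesis unfolding gradient_within_def by blast
qed

section \<open>Spaces of tuples\<close>

lemma subspace_tuples: "subspace V \<Longrightarrow> subspace (tuples V)"
  by (auto simp: subspace_def tuples_def)

text \<open>Every tuple is the sum of its entries placed in their slots. For finite \<open>B\<close>
  this makes the tuple space a finite span, to which the linear algebra on spans applies.\<close>

lemma tuples_span_axis:
  "tuples (span B) = span ((\<lambda>(i, b). axis i b :: L2^'n) ` (UNIV \<times> B))" (is "_ = span ?A")
proof
  show "span ?A \<subseteq> tuples (span B)"
  proof (rule span_minimal)
    show "?A \<subseteq> tuples (span B)"
      by (auto simp: tuples_def axis_def span_base span_zero)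
  qed (simp add: subspace_tuples)
next
  have axis_in: "(axis i v :: L2^'n) \<in> span ?A" if "v \<in> span B" for i v
    using that
  proof (induction rule: span_induct_alt)
    case base
    have zero: "(axis i 0 :: L2^'n) = 0" by simp
    show ?case unfolding zero by (rule span_zero)
  next
    case (step c b v)
    have "(axis i (c *\<^sub>R b + v) :: L2^'n) = c *\<^sub>R axis i b + axis i v"
      by (simp add: vec_eq_iff axis_def)
    moreover have "(axis i b :: L2^'n) \<in> span ?A"
      using step by (intro span_base) auto
    ultimately show ?case using step by (simp add: span_add span_scale)
  qed
  show "tuples (span B) \<subseteq> span ?A"
  proof
    fix U :: "L2^'n" assume "U \<in> tuples (span B)"
    then have "(\<Sum>i\<in>UNIV. axis i (U $ i)) \<in> span ?A"
      by (intro span_sum axis_in) (auto simp: tuples_def)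
    moreover have "(\<Sum>i\<in>UNIV. axis i (U $ i)) = U"
      by (simp add: vec_eq_iff axis_def if_distrib[of "\<lambda>f. f $ _"] cong: if_cong)
    ultimately show "U \<in> span ?A" by simp
  qed
qed

lemma tuple_mult_in_tuples: "subspace V \<Longrightarrow> U \<in> tuples V \<Longrightarrow> tuple_mult U P \<in> tuples V"
  by (auto simp: tuples_def tuple_mult_def intro!: subspace_sum subspace_scale)

text \<open>Entry \<open>i\<close> of \<open>tuple_mult U P\<close> uses column \<open>i\<close> of
  \<open>P\<close>, so a tuple behaves like a matrix with functions as columns, multiplied by
  \<open>P\<close> on the right.\<close>

lemma gram_tuple_mult: "gram W (tuple_mult U P) = gram W U ** P"
  by (simp add: vec_eq_iff gram_def tuple_mult_def matrix_matrix_mult_def inner_sum_right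
      mult.commute)

lemma transpose_gram: "transpose (gram U W) = gram W U"
  by (simp add: vec_eq_iff gram_def transpose_def inner_commute)

lemma gram_add_left: "gram (U + U') W = gram U W + gram U' W"
  and gram_add_right: "gram U (W + W') = gram U W + gram U W'"
  and gram_diff_left: "gram (U - U') W = gram U W - gram U' W"
  and gram_diff_right: "gram U (W - W') = gram U W - gram U W'"
  and gram_scaleR_left: "gram (c *\<^sub>R U) W = c *\<^sub>R gram U W"
  and gram_scaleR_right: "gram U (c *\<^sub>R W) = c *\<^sub>R gram U W"
  by (simp_all add: vec_eq_iff gram_def inner_add_left inner_add_right inner_diff_left
      inner_diff_right)

lemma tuple_mult_add: "tuple_mult U (P + Q) = tuple_mult U P + tuple_mult U Q"
  by (simp add: vec_eq_iff tuple_mult_def scaleR_add_left sum.distrib)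

lemma tuple_mult_scaleR: "tuple_mult U (c *\<^sub>R P) = c *\<^sub>R tuple_mult U P"
  by (simp add: vec_eq_iff tuple_mult_def scaleR_sum_right)

section \<open>The skew operator and its resolvent\<close>

lemma linear_skew_operator: "linear (skew_operator gradE U)"
  by (rule linearI) (simp_all add: skew_operator_def gram_add_right gram_scaleR_right
      tuple_mult_add tuple_mult_scaleR scaleR_diff_right)

text \<open>The entries are linear combinations of entries of \<open>U\<close> and
  \<open>gradE U\<close>; \<open>W\<close> enters only through the coefficients.\<close>

lemma skew_operator_in_tuples:
  assumes "subspace V" "U \<in> tuples V" "gradE U \<in> tuples V"
  shows "skew_operator gradE U W \<in> tuples V"
  unfolding skew_operator_def
  using assms by (intro subspace_diff subspace_tuples tuple_mult_in_tuples)

text \<open>The two terms of the operator contribute a matrix \<open>?M\<close> and its transpose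
  with opposite signs. Antisymmetry of the whole matrix, stronger than the vanishing of its trace,
  is what preserves every entry of the Gram matrix later.\<close>

lemma gram_skew_operator_antisym:
  "gram (skew_operator gradE U W) W = - gram W (skew_operator gradE U W)"
proof -
  let ?M = "gram W (gradE U) ** gram U W"
  have eq: "gram W (skew_operator gradE U W) = ?M - transpose ?M"
    by (simp add: skew_operator_def gram_diff_right gram_tuple_mult matrix_transpose_mul
        transpose_gram)
  have "gram (skew_operator gradE U W) W = transpose (?M - transpose ?M)"
    by (simp add: eq[symmetric] transpose_gram)
  also have "\<dots> = - (?M - transpose ?M)"
    by (simp add: vec_eq_iff transpose_def)
  finally show ?thesis by (simp add: eq)
qed

text \<open>Traces of the antisymmetric Gram matrix; this is the form that yields injectivity of I +
  s A.\<close>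

lemma inner_skew_operator: "inner W (skew_operator gradE U W) = 0"
proof -
  have "tuple_inner (skew_operator gradE U W) W = - tuple_inner W (skew_operator gradE U W)"
    unfolding tuple_inner_def gram_skew_operator_antisym by (simp add: trace_def sum_negf)
  then show ?thesis
    by (simp add: tuple_inner_eq_inner inner_commute)
qed

text \<open>The update is the Cayley transform of \<open>U\<close>. The point \<open>X\<close> at
  which the operator is frozen is arbitrary, so orthogonality does not depend on convergence of the
  inner iteration.\<close>

lemma gram_cayley:
  fixes U :: "L2^'n"
  assumes "W + s *\<^sub>R skew_operator gradE X W = U"
  shows "gram (2 *\<^sub>R W - U) (2 *\<^sub>R W - U) = gram U U"
proof -
  let ?A = "skew_operator gradE X W"
  have "2 *\<^sub>R W - U = W - s *\<^sub>R ?A"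
    using assms by (auto simp: scaleR_2)
  moreover have "gram (W - s *\<^sub>R ?A) (W - s *\<^sub>R ?A) = gram (W + s *\<^sub>R ?A) (W + s *\<^sub>R ?A)"
    by (simp add: gram_add_left gram_add_right gram_diff_left gram_diff_right
        gram_scaleR_left gram_scaleR_right gram_skew_operator_antisym algebra_simps)
  ultimately show ?thesis using assms by simp
qed

text \<open>A basis \<open>C\<close> of the span is mapped to an independent set of the same size. A
  basis vector outside the span of that image could be added to it, giving an independent set in
  \<open>span C\<close> with more than \<open>card C\<close> elements.\<close>

lemma linear_inj_on_span_imp_surj:
  fixes T :: "'a::real_vector \<Rightarrow> 'a"
  assumes "finite B" and T: "linear T" and sub: "T ` span B \<subseteq> span B" and inj: "inj_on T (span B)"
  shows "T ` span B = span B"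
proof -
  obtain C where C: "C \<subseteq> B" "independent C" and BC: "B \<subseteq> span C"
    using maximal_independent_subset[of B] by blast
  have span_C: "span C = span B"
    using span_mono[OF C(1)] span_minimal[OF BC subspace_span] by (rule subset_antisym)
  have C_sub: "C \<subseteq> span B" using span_superset[of C] span_C by simp
  have fin: "finite C" using C(1) \<open>finite B\<close> by (rule finite_subset)
  have indep: "independent (T ` C)"
    using linear_independent_injective_image[OF T C(2)] inj span_C by simp
  have card: "card (T ` C) = card C"
    using inj_on_subset[OF inj C_sub] by (rule card_image)
  have "T ` C \<subseteq> span C" using sub C_sub span_C by blast
  have "C \<subseteq> span (T ` C)"
  proof
    fix a assume "a \<in> C"
    show "a \<in> span (T ` C)"
    proof (rule ccontr)
      assume a: "a \<notin> span (T ` C)"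
      then have "a \<notin> T ` C" using span_base[of a "T ` C"] by auto
      then have "card (insert a (T ` C)) = Suc (card C)" using card fin by simp
      moreover have "independent (insert a (T ` C))"
        using a indep by (rule independent_insertI)
      moreover have "insert a (T ` C) \<subseteq> span C"
        using \<open>T ` C \<subseteq> span C\<close> span_base[OF \<open>a \<in> C\<close>] by simp
      ultimately show False
        using independent_span_bound[OF fin, of "insert a (T ` C)"] by simp
    qed
  qed
  then have "span C \<subseteq> span (T ` C)" by (simp add: span_minimal)
  then have "span B \<subseteq> T ` span B" by (simp only: linear_span_image[OF T] span_C)
  with sub show ?thesis by (rule subset_antisym)
qed

text \<open>\<open>the_inv_into\<close> has a meaningful value only at points of the image of an
  injective map, so the resolvent equation rests on bijectivity of I + s A on
  \<open>tuples V\<close>.\<close>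

lemma resolvent_on_tuples:
  fixes X U :: "L2^'n" and s :: real
  assumes V: "V = span B" "finite B"
    and X: "X \<in> tuples V" "gradE X \<in> tuples V" and U: "U \<in> tuples V"
  defines "W \<equiv> resolvent_on (tuples V) gradE s X U"
  shows "W \<in> tuples V" and "W + s *\<^sub>R skew_operator gradE X W = U"
proof -
  let ?T = "\<lambda>W. W + s *\<^sub>R skew_operator gradE X W"
  let ?C = "(\<lambda>(i, b). axis i b :: L2^'n) ` (UNIV \<times> B)"
  have S: "tuples V = span ?C" using V(1) tuples_span_axis by simp
  have V': "subspace V" using V by simp
  have lin: "linear ?T"
    by (intro linear_compose_add linear_compose_scale_right linear_skew_operator
        linear_id[unfolded id_def])
  have maps: "?T ` tuples V \<subseteq> tuples V"
    using V' X by (auto intro!: subspace_add subspace_scale subspace_tuples skew_operator_in_tuples)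
  have "inj ?T"
  proof (subst linear_injective_0[OF lin], intro allI impI)
    fix W assume "?T W = 0"
    \<comment> \<open>By skewness, pairing \<open>?T W\<close> with \<open>W\<close> leaves only
      \<open>inner W W\<close>, whatever \<open>s\<close> is.\<close>
    then have "inner W (?T W) = 0" by simp
    then show "W = 0" by (simp add: inner_add_right inner_skew_operator)
  qed
  then have inj: "inj_on ?T (tuples V)" by (rule inj_on_subset) simp
  have "?T ` tuples V = tuples V"
    using linear_inj_on_span_imp_surj[OF _ lin, of ?C] maps inj V(2) S by simp
  then have img: "U \<in> ?T ` tuples V" using U by simp
  show "W \<in> tuples V"
    unfolding W_def resolvent_on_def using the_inv_into_into[OF inj img] by blast
  show "W + s *\<^sub>R skew_operator gradE X W = U"
    unfolding W_def resolvent_on_def using f_the_inv_into_f[OF inj img] by simp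
qed

section \<open>Orthogonality along the iteration\<close>

lemma orthogonality_preserving_step:
  fixes U :: "nat \<Rightarrow> L2^'n"
  assumes V: "V = span B" "finite B"
    and grad: "\<And>X. X \<in> tuples V \<Longrightarrow> gradE X \<in> tuples V"
    and iter: "orthogonality_preserving_iteration (tuples V) gradE dt p U Uhalf"
    and p: "p n \<ge> 1" and U: "U n \<in> tuples V"
  shows "U (Suc n) \<in> tuples V" and "gram (U (Suc n)) (U (Suc n)) = gram (U n) (U n)"
proof -
  note it = iter[unfolded orthogonality_preserving_iteration_def, rule_format, of n]
  have half_Suc: "Uhalf n (Suc k) = resolvent_on (tuples V) gradE (dt n / 2) (Uhalf n k) (U n)"
    if "Suc k \<le> p n" for k
    using it that by auto
  \<comment> \<open>Each inner iterate fixes the operator of the next solve, and the resolvent is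
    controlled only for operators frozen at points of \<open>tuples V\<close>.\<close>
  have half: "Uhalf n k \<in> tuples V" if "k \<le> p n" for k
    using that
  proof (induction k)
    case 0
    then show ?case using it U by simp
  next
    case (Suc k)
    then have X: "Uhalf n k \<in> tuples V" by simp
    show ?case
      using resolvent_on_tuples(1)[where gradE = gradE, OF V X grad[OF X] U]
      half_Suc[OF Suc.prems] by simp
  qed
  \<comment> \<open>Iterate \<open>Suc m\<close> is the last inner solve, with the operator frozen
    at iterate \<open>m\<close>; its equation alone determines the Gram matrix of the
    update.\<close>
  obtain m where m: "p n = Suc m" using p by (cases "p n") auto
  have X: "Uhalf n m \<in> tuples V" using half[of m] m by simp
  have "Uhalf n (p n) + (dt n / 2) *\<^sub>R skew_operator gradE (Uhalf n m) (Uhalf n (p n)) = U n"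
    using resolvent_on_tuples(2)[where gradE = gradE, OF V X grad[OF X] U] half_Suc[of m] m
    by simp
  from gram_cayley[OF this] show "gram (U (Suc n)) (U (Suc n)) = gram (U n) (U n)"
    using it by simp
  have "subspace (tuples V :: (L2^'n) set)" using V by (simp add: subspace_tuples)
  then show "U (Suc n) \<in> tuples V"
    using it half[of "p n"] U by (simp add: subspace_diff subspace_scale)
qed

theorem proposition5p2:
  fixes V :: "L2 set" and Ng :: nat
    and Vext :: "real^3 \<Rightarrow> real"
    and exc vxc :: "(real^3 \<Rightarrow> real) \<Rightarrow> real^3 \<Rightarrow> real"
    and dt :: "nat \<Rightarrow> real" and p :: "nat \<Rightarrow> nat"
    and U :: "nat \<Rightarrow> L2^'n" and Uhalf :: "nat \<Rightarrow> nat \<Rightarrow> L2^'n"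
  assumes "subspace V" and "V \<subseteq> H1"
    and "\<exists>B. finite B \<and> span B = V" and "dim V = Ng"
    and "xc_potential_on (tuples V :: (L2^'n) set) exc vxc"
    and "\<forall>W\<in>(tuples V :: (L2^'n) set).
           kohn_sham_energy Vext exc differentiable (at W within tuples V)"
    and "U 0 \<in> tuples V \<inter> stiefel"
    and "\<And>n. dt n > 0" and "\<And>n. p n \<ge> 1"
    and "orthogonality_preserving_iteration (tuples V)
           (gradient_within (tuples V) (kohn_sham_energy Vext exc)) dt p U Uhalf"
  shows "\<forall>n. U n \<in> tuples V \<inter> stiefel"
proof -
  obtain B where B: "V = span B" "finite B" using assms(3) by blast
  let ?grad = "gradient_within (tuples V) (kohn_sham_energy Vext exc) :: L2^'n \<Rightarrow> L2^'n"
  \<comment> \<open>This links the energy to the abstract step: differentiability along the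
    finite-dimensional \<open>tuples V\<close> places the gradient back in
    \<open>tuples V\<close>.\<close>
  have grad: "?grad X \<in> tuples V" if "X \<in> tuples V" for X
    using gradient_within_in[OF tuples_span_axis[of B, folded B(1)] _ that] B(2) assms(6) that
    by simp
  note step = orthogonality_preserving_step[OF B grad assms(10) assms(9)]
  \<comment> \<open>The two facts go through one induction, since a step preserves the Gram matrix
    of an iterate known to lie in \<open>tuples V\<close>. The Sobolev part of
    \<open>stiefel\<close> follows afterwards from \<open>V \<subseteq> H1\<close>.\<close>
  have "U n \<in> tuples V \<and> gram (U n) (U n) = mat 1" for n
  proof (induction n)
    case 0
    then show ?case using assms(7) by (simp add: stiefel_def)
  next
    case (Suc n)
    then show ?case using step[of n] by simp
  qed
  moreover have "tuples V \<subseteq> (tuples H1 :: (L2^'n) set)" using assms(2) by (auto simp: tuples_def)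
  ultimately show ?thesis by (auto simp: stiefel_def)
qed

end
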